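(* Let $\Gamma=(V,E)$ be an infinite weighted graph and let $\Omega\subset V$ be a finite, connected subset with at least two vertices. Then $\lambda_1(\Omega)+\lambda_{\mathrm{max}}(\Omega)=2$ if and only if $\Omega$ is bipartite.
   Context: $\Gamma=(V,E)$ is a locally finite, connected graph with infinitely many vertices, equipped with symmetric edge weights $\mu_{xy}=\mu_{yx}\ge 0$, where $\mu_{xy}>0$ iff $(x,y)\in E$; self-loops ($\mu_{xx}>0$) are allowed. Put $\mu(x)=\sum_{y\in V}\mu_{xy}$. The Dirichlet Laplace operator on $\Omega$ acts on real functions $f$ on $\Omega$ by $\Delta_\Omega f(x)=f(x)-\frac{1}{\mu(x)}\sum_{y\in\Omega}\mu_{xy}f(y)$, $x\in\Omega$ (note $\mu(x)$ is the full degree in $\Gamma$). It is self-adjoint with respect to $(f,g)_\mu=\sum_{x\in\Omega}\mu(x)f(x)g(x)$; $\lambda_1(\Omega)$ and $\lambda_{\mathrm{max}}(\Omega)$ denote its smallest and largest eigenvalues. $\Omega$ is connected (bipartite) if the induced subgraph of $\Gamma$ on $\Omega$ is connected (bipartite). Bipartite means the vertex set splits into two parts with no edges inside either part; equivalently there is no cycle of odd length (a self-loop counts as a cycle of length 1). *)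

theory Defs
  imports "HOL-Analysis.Analysis"
begin

definition induced_edges :: "('a \<times> 'a) set \<Rightarrow> 'a set \<Rightarrow> ('a \<times> 'a) set" where
  "induced_edges E W = E \<inter> (W \<times> W)"

definition connected_graph :: "'a set \<Rightarrow> ('a \<times> 'a) set \<Rightarrow> bool" where
  "connected_graph V E \<longleftrightarrow> (\<forall>x\<in>V. \<forall>y\<in>V. (x, y) \<in> E\<^sup>*)"

text \<open>A loop \<open>(x, x) \<in> E\<close> is an edge inside the part of \<open>x\<close>, so it rules out bipartiteness.\<close>

definition bipartite_graph :: "'a set \<Rightarrow> ('a \<times> 'a) set \<Rightarrow> bool" where
  "bipartite_graph V E \<longleftrightarrow>
     (\<exists>A B. A \<union> B = V \<and> A \<inter> B = {} \<and> E \<inter> (A \<times> A) = {} \<and> E \<inter> (B \<times> B) = {})"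

locale infinite_weighted_graph =
  fixes V :: "'a set" and E :: "('a \<times> 'a) set" and \<mu> :: "'a \<Rightarrow> 'a \<Rightarrow> real"
  assumes infinite_vertices: "infinite V"
    and edges_subset: "E \<subseteq> V \<times> V"
    and weight_sym: "\<And>x y. x \<in> V \<Longrightarrow> y \<in> V \<Longrightarrow> \<mu> x y = \<mu> y x"
    and weight_nonneg: "\<And>x y. x \<in> V \<Longrightarrow> y \<in> V \<Longrightarrow> \<mu> x y \<ge> 0"
    and weight_pos_iff: "\<And>x y. x \<in> V \<Longrightarrow> y \<in> V \<Longrightarrow> \<mu> x y > 0 \<longleftrightarrow> (x, y) \<in> E"
    and locally_finite: "\<And>x. x \<in> V \<Longrightarrow> finite {y \<in> V. (x, y) \<in> E}"
    and connected: "connected_graph V E"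

text \<open>By local finiteness the following sum has only finitely many nonzero terms;
  \<open>infsum\<close> is used because \<open>sum\<close> over the infinite set \<open>V\<close> would be \<open>0\<close>.\<close>

definition vertex_weight :: "'a set \<Rightarrow> ('a \<Rightarrow> 'a \<Rightarrow> real) \<Rightarrow> 'a \<Rightarrow> real" where
  "vertex_weight V \<mu> x = (\<Sum>\<^sub>\<infinity>y\<in>V. \<mu> x y)"

text \<open>Functions on \<open>\<Omega>\<close> are represented by functions on the whole type; the values outside
  \<open>\<Omega>\<close> play no role in the two definitions below.\<close>

definition dirichlet_laplace ::
  "'a set \<Rightarrow> ('a \<Rightarrow> 'a \<Rightarrow> real) \<Rightarrow> 'a set \<Rightarrow> ('a \<Rightarrow> real) \<Rightarrow> 'a \<Rightarrow> real" where
  "dirichlet_laplace V \<mu> \<Omega> f x = f x - (1 / vertex_weight V \<mu> x) * (\<Sum>y\<in>\<Omega>. \<mu> x y * f y)"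

definition dirichlet_eigenvalue ::
  "'a set \<Rightarrow> ('a \<Rightarrow> 'a \<Rightarrow> real) \<Rightarrow> 'a set \<Rightarrow> real \<Rightarrow> bool" where
  "dirichlet_eigenvalue V \<mu> \<Omega> l \<longleftrightarrow>
     (\<exists>f. (\<exists>x\<in>\<Omega>. f x \<noteq> 0) \<and> (\<forall>x\<in>\<Omega>. dirichlet_laplace V \<mu> \<Omega> f x = l * f x))"

definition lambda_1 :: "'a set \<Rightarrow> ('a \<Rightarrow> 'a \<Rightarrow> real) \<Rightarrow> 'a set \<Rightarrow> real" where
  "lambda_1 V \<mu> \<Omega> = (LEAST l. dirichlet_eigenvalue V \<mu> \<Omega> l)"

definition lambda_max :: "'a set \<Rightarrow> ('a \<Rightarrow> 'a \<Rightarrow> real) \<Rightarrow> 'a set \<Rightarrow> real" where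
  "lambda_max V \<mu> \<Omega> = (GREATEST l. dirichlet_eigenvalue V \<mu> \<Omega> l)"

end

theory Submission
  imports Defs
begin

text \<open>
  Write \<open>w\<close> for the edge weights on \<open>\<Omega>\<close> and \<open>m\<close> for the full degrees.  A number \<open>l\<close> is a
  Dirichlet eigenvalue exactly if \<open>a = 1 - l\<close> solves \<open>(\<Sum>y\<in>\<Omega>. w x y * f y) = a * m x * f x\<close> for
  some nonzero \<open>f\<close>.  The extreme values of \<open>a\<close> are the extreme values of the Rayleigh quotient
  \<open>Q f / N f\<close> (lemmas \<open>rayleigh_maximum_exists\<close> and \<open>maximiser_eigenfunction\<close>), where \<open>Q f = (\<Sum>x\<in>\<Omega>. \<Sum>y\<in>\<Omega>. w x y * f x * f y)\<close> and
  \<open>N f = (\<Sum>x\<in>\<Omega>. m x * (f x)\<^sup>2)\<close>.  If \<open>M\<close> is the maximum of that quotient and \<open>- M'\<close> its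
  minimum, then \<open>\<lambda>\<^sub>1 = 1 - M\<close> and \<open>\<lambda>\<^sub>m\<^sub>a\<^sub>x = 1 + M'\<close>, so the claim is that \<open>M = M'\<close> if and only
  if \<open>\<Omega>\<close> is bipartite.

  If \<open>\<Omega>\<close> is bipartite, changing the sign of \<open>f\<close> on one part preserves \<open>N f\<close> and negates
  \<open>Q f\<close>, so the range of the quotient is symmetric about \<open>0\<close> (lemma \<open>bipartite_energy_flip\<close>).

  Conversely let \<open>M = M'\<close> and let \<open>f\<close> attain the minimum: \<open>Q f = - M * N f\<close>.  The weights are
  nonnegative, so \<open>Q \<bar>f\<bar> \<ge> - Q f = M * N \<bar>f\<bar>\<close>, and \<open>\<bar>f\<bar>\<close> attains the maximum.  It is then
  itself an eigenfunction, and the eigenvalue equation at a zero of \<open>\<bar>f\<bar>\<close> forces all neighbours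
  to be zeros; by connectedness \<open>f\<close> vanishes nowhere on \<open>\<Omega>\<close>.  Finally \<open>Q \<bar>f\<bar> + Q f = 0\<close> is a
  sum of nonnegative terms, so \<open>f x * f y < 0\<close> on every edge: the sign of \<open>f\<close> is a
  two-colouring, which in particular excludes loops (lemma \<open>bipartite_if_extrema_opposite\<close>).
\<close>

section \<open>Extremal eigenvalues of a symmetric form on a finite set\<close>

text \<open>The weights \<open>w\<close> may have either sign, so that the results about the largest eigenvalue also
  give the smallest one, by passing from \<open>w\<close> to \<open>- w\<close>.\<close>

locale finite_symmetric_form =
  fixes \<Omega> :: "'a set" and w :: "'a \<Rightarrow> 'a \<Rightarrow> real" and m :: "'a \<Rightarrow> real"
  assumes finite_carrier: "finite \<Omega>"
    and carrier_nonempty: "\<Omega> \<noteq> {}"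
    and mass_pos: "x \<in> \<Omega> \<Longrightarrow> m x > 0"
    and form_sym: "x \<in> \<Omega> \<Longrightarrow> y \<in> \<Omega> \<Longrightarrow> w x y = w y x"
begin

definition apply_form :: "('a \<Rightarrow> real) \<Rightarrow> 'a \<Rightarrow> real" where
  "apply_form f x = (\<Sum>y\<in>\<Omega>. w x y * f y)"

definition energy :: "('a \<Rightarrow> real) \<Rightarrow> real" where
  "energy f = (\<Sum>x\<in>\<Omega>. f x * apply_form f x)"

definition sq_norm :: "('a \<Rightarrow> real) \<Rightarrow> real" where
  "sq_norm f = (\<Sum>x\<in>\<Omega>. m x * (f x)\<^sup>2)"

definition eigenfunction :: "real \<Rightarrow> ('a \<Rightarrow> real) \<Rightarrow> bool" where
  "eigenfunction a f \<longleftrightarrow>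
     (\<exists>x\<in>\<Omega>. f x \<noteq> 0) \<and> (\<forall>x\<in>\<Omega>. apply_form f x = a * m x * f x)"

lemma energy_eq_double_sum: "energy f = (\<Sum>x\<in>\<Omega>. \<Sum>y\<in>\<Omega>. w x y * (f x * f y))"
  unfolding energy_def apply_form_def
  by (simp add: sum_distrib_left algebra_simps)

lemma sq_norm_pos: "sq_norm f > 0" if "\<exists>x\<in>\<Omega>. f x \<noteq> 0"
proof -
  from that obtain x where x: "x \<in> \<Omega>" "f x \<noteq> 0" by blast
  show ?thesis unfolding sq_norm_def
  proof (rule sum_pos2[OF finite_carrier x(1)])
    show "0 < m x * (f x)\<^sup>2" using x mass_pos by simp
    show "0 \<le> m i * (f i)\<^sup>2" if "i \<in> \<Omega>" for i
      using mass_pos[OF that] by simp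
  qed
qed

lemma eigenfunction_energy:
  assumes "eigenfunction a f"
  shows "energy f = a * sq_norm f"
  using assms unfolding eigenfunction_def energy_def sq_norm_def
  by (simp add: sum_distrib_left power2_eq_square algebra_simps cong: sum.cong)

lemma energy_perturb:
  assumes "z \<in> \<Omega>"
  shows "energy (\<lambda>x. f x + t * of_bool (x = z)) =
    energy f + 2 * t * apply_form f z + t\<^sup>2 * w z z"
proof -
  have L: "apply_form (\<lambda>x. f x + t * of_bool (x = z)) x = apply_form f x + t * w x z" for x
  proof -
    have "(\<Sum>y\<in>\<Omega>. w x y * (t * of_bool (y = z))) = (\<Sum>y\<in>\<Omega>. if y = z then t * w x z else 0)"
      by (rule sum.cong) auto
    also have "\<dots> = t * w x z" using assms finite_carrier by simp
    finally show ?thesis unfolding apply_form_def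
      by (simp add: distrib_left sum.distrib)
  qed
  have sym: "(\<Sum>x\<in>\<Omega>. f x * w x z) = apply_form f z"
    unfolding apply_form_def using assms form_sym by (intro sum.cong) auto
  have delta: "(\<Sum>x\<in>\<Omega>. of_bool (x = z) * g x) = g z" for g :: "'a \<Rightarrow> real"
  proof -
    have "(\<Sum>x\<in>\<Omega>. of_bool (x = z) * g x) = (\<Sum>x\<in>\<Omega>. if x = z then g z else 0)"
      by (rule sum.cong) auto
    then show ?thesis using assms finite_carrier by simp
  qed
  have "energy (\<lambda>x. f x + t * of_bool (x = z)) =
      (\<Sum>x\<in>\<Omega>. f x * apply_form f x + t * (f x * w x z)
        + t * (of_bool (x = z) * apply_form f x) + t\<^sup>2 * (of_bool (x = z) * w x z))"
    unfolding energy_def L by (intro sum.cong) (auto simp: algebra_simps power2_eq_square)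
  also have "\<dots> = energy f + t * apply_form f z + t * apply_form f z + t\<^sup>2 * w z z"
    unfolding sum.distrib sum_distrib_left[symmetric] delta sym energy_def ..
  finally show ?thesis by simp
qed

lemma sq_norm_perturb:
  assumes "z \<in> \<Omega>"
  shows "sq_norm (\<lambda>x. f x + t * of_bool (x = z)) =
    sq_norm f + 2 * t * (m z * f z) + t\<^sup>2 * m z"
proof -
  have "sq_norm (\<lambda>x. f x + t * of_bool (x = z)) =
      (\<Sum>x\<in>\<Omega>. m x * (f x)\<^sup>2 + (if x = z then 2 * t * (m z * f z) + t\<^sup>2 * m z else 0))"
    unfolding sq_norm_def by (intro sum.cong) (auto simp: algebra_simps power2_eq_square)
  then show ?thesis
    using assms finite_carrier by (simp add: sum.distrib sq_norm_def)
qed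

text \<open>A maximiser of the Rayleigh quotient is an eigenfunction, because the quotient is stationary
  there: moving the value at one vertex \<open>z\<close> by \<open>t\<close> changes \<open>energy - M * sq_norm\<close> by
  \<open>2 * t * A + t\<^sup>2 * B\<close>, which can stay nonpositive for all \<open>t\<close> only if the residual \<open>A\<close> of
  the eigenvalue equation at \<open>z\<close> is zero.\<close>

lemma maximiser_eigenfunction:
  assumes bound: "\<And>g. energy g \<le> M * sq_norm g"
    and attained: "energy f = M * sq_norm f"
    and nonzero: "\<exists>x\<in>\<Omega>. f x \<noteq> 0"
  shows "eigenfunction M f"
  unfolding eigenfunction_def
proof (intro conjI ballI nonzero)
  fix z assume z: "z \<in> \<Omega>"
  define A where "A = apply_form f z - M * m z * f z"
  define B where "B = w z z - M * m z"
  have le: "2 * t * A + t\<^sup>2 * B \<le> 0" for t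
    using bound[of "\<lambda>x. f x + t * of_bool (x = z)"]
    unfolding energy_perturb[OF z] sq_norm_perturb[OF z] attained A_def B_def
    by (simp add: algebra_simps)
  define c where "c = \<bar>B\<bar> + 1"
  have c: "c > 0" "2 * c + B > 0" unfolding c_def by auto
  \<comment> \<open>At \<open>t = A / c\<close> the expression equals \<open>A\<^sup>2 * (2 * c + B) / c\<^sup>2\<close>.\<close>
  have "2 * (A / c) * A + (A / c)\<^sup>2 * B = A\<^sup>2 * ((2 * c + B) / c\<^sup>2)"
    using c(1) by (simp add: field_simps power2_eq_square)
  with le[of "A / c"] have "A\<^sup>2 * ((2 * c + B) / c\<^sup>2) \<le> 0" by simp
  moreover have "(2 * c + B) / c\<^sup>2 > 0" using c by simp
  ultimately have "A\<^sup>2 \<le> 0" using mult_pos_pos linorder_not_less by blast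
  then show "apply_form f z = M * m z * f z" by (simp add: A_def)
qed

lemma energy_scale: "energy (\<lambda>x. c * f x) = c\<^sup>2 * energy f"
  unfolding energy_eq_double_sum
  by (simp add: sum_distrib_left power2_eq_square algebra_simps)

lemma sq_norm_scale: "sq_norm (\<lambda>x. c * f x) = c\<^sup>2 * sq_norm f"
  unfolding sq_norm_def
  by (simp add: sum_distrib_left power2_eq_square algebra_simps)

lemma continuous_energy: "continuous_on UNIV energy"
  unfolding energy_eq_double_sum by (intro continuous_intros continuous_on_product_coordinates)

lemma continuous_sq_norm: "continuous_on UNIV sq_norm"
  unfolding sq_norm_def by (intro continuous_intros continuous_on_product_coordinates)

text \<open>The unit sphere of \<open>sq_norm\<close>, restricted to functions that vanish off \<open>\<Omega>\<close>, is a closed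
  subset of a product of compact intervals, so it is compact by Tychonoff's theorem and the energy
  attains its maximum there; homogeneity extends the bound to all functions.\<close>

lemma rayleigh_maximum_exists:
  "\<exists>M f. (\<exists>x\<in>\<Omega>. f x \<noteq> 0) \<and> energy f = M * sq_norm f \<and>
    (\<forall>g. energy g \<le> M * sq_norm g)"
proof -
  define I where "I = (\<lambda>x. if x \<in> \<Omega> then {- sqrt (1 / m x)..sqrt (1 / m x)} else {0})"
  define S where "S = PiE UNIV I \<inter> {f. sq_norm f = 1}"
  have "compact (I x)" for x unfolding I_def by simp
  then have "compactin (product_topology (\<lambda>_. euclidean) UNIV) (PiE UNIV I)"
    unfolding compactin_PiE by simp
  then have "compact (PiE UNIV I)"
    by (simp add: euclidean_product_topology)
  moreover have "closed {f. sq_norm f = 1}"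
    using closed_Collect_eq[of sq_norm "\<lambda>_. 1"] continuous_sq_norm by simp
  ultimately have compact: "compact S" unfolding S_def by (rule compact_Int_closed)
  have normalise: "\<exists>h\<in>S. \<exists>c. c\<^sup>2 = sq_norm g \<and> (\<forall>x\<in>\<Omega>. g x = c * h x)"
    if g: "\<exists>x\<in>\<Omega>. g x \<noteq> 0" for g
  proof -
    define c where "c = sqrt (sq_norm g)"
    define h where "h = (\<lambda>x. if x \<in> \<Omega> then inverse c * g x else 0)"
    have c: "c > 0" "c\<^sup>2 = sq_norm g" using sq_norm_pos[OF g] unfolding c_def by auto
    have "sq_norm h = sq_norm (\<lambda>x. inverse c * g x)"
      unfolding sq_norm_def h_def by (intro sum.cong) auto
    also have "\<dots> = 1" unfolding sq_norm_scale c(2)[symmetric]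
      using c(1) by (simp add: power2_eq_square field_simps)
    finally have h1: "sq_norm h = 1" .
    have "\<bar>h x\<bar> \<le> sqrt (1 / m x)" if x: "x \<in> \<Omega>" for x
    proof -
      have "m x * (h x)\<^sup>2 \<le> sq_norm h" unfolding sq_norm_def
        using mass_pos finite_carrier x
        by (intro member_le_sum[of x \<Omega> "\<lambda>x. m x * (h x)\<^sup>2"]) (auto simp: less_imp_le)
      then have "(h x)\<^sup>2 \<le> 1 / m x"
        using h1 mass_pos[OF x] by (simp add: field_simps)
      then show ?thesis using real_le_rsqrt[of "\<bar>h x\<bar>"] by simp
    qed
    then have "h x \<in> I x" for x
      by (cases "x \<in> \<Omega>") (auto simp: I_def abs_le_iff minus_le_iff, simp add: h_def)
    then have "h \<in> S" using h1 unfolding S_def by (simp add: PiE_UNIV_domain)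
    moreover have "\<forall>x\<in>\<Omega>. g x = c * h x" using c(1) by (simp add: h_def)
    ultimately show ?thesis using c(2) by blast
  qed
  from carrier_nonempty have "\<exists>x\<in>\<Omega>. (\<lambda>_. 1::real) x \<noteq> 0" by auto
  from normalise[OF this] have "S \<noteq> {}" by blast
  from continuous_attains_sup[OF compact this continuous_on_subset[OF continuous_energy]]
  obtain f where f: "f \<in> S" "\<forall>h\<in>S. energy h \<le> energy f" by auto
  have f1: "sq_norm f = 1" using f(1) by (simp add: S_def)
  show ?thesis
  proof (intro exI conjI allI)
    show "\<exists>x\<in>\<Omega>. f x \<noteq> 0"
    proof (rule ccontr)
      assume "\<not> ?thesis"
      then have "sq_norm f = 0" unfolding sq_norm_def by simp
      with f1 show False by simp
    qed
    show "energy f = energy f * sq_norm f" using f1 by simp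
    fix g show "energy g \<le> energy f * sq_norm g"
    proof (cases "\<exists>x\<in>\<Omega>. g x \<noteq> 0")
      case True
      from normalise[OF this] obtain h c where
        h: "h \<in> S" "c\<^sup>2 = sq_norm g" "\<forall>x\<in>\<Omega>. g x = c * h x" by blast
      have "energy g = energy (\<lambda>x. c * h x)"
        unfolding energy_eq_double_sum using h(3) by (intro sum.cong refl) simp
      also have "\<dots> = energy h * sq_norm g" unfolding energy_scale h(2) by simp
      also have "\<dots> \<le> energy f * sq_norm g"
        using f(2) h(1) by (simp add: mult_right_mono flip: h(2))
      finally show ?thesis .
    next
      case False
      then show ?thesis by (simp add: energy_def sq_norm_def)
    qed
  qed
qed

lemma eigenvalue_le_maximum:
  assumes "\<And>g. energy g \<le> M * sq_norm g" and "eigenfunction a f"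
  shows "a \<le> M"
proof -
  have "sq_norm f > 0" using assms(2) sq_norm_pos unfolding eigenfunction_def by blast
  moreover have "a * sq_norm f \<le> M * sq_norm f"
    using assms(1)[of f] eigenfunction_energy[OF assms(2)] by simp
  ultimately show ?thesis by simp
qed

end

section \<open>The lower end of the spectrum\<close>

context finite_symmetric_form
begin

lemma negated_form: "finite_symmetric_form \<Omega> (\<lambda>x y. - w x y) m"
  using finite_carrier carrier_nonempty mass_pos form_sym by unfold_locales auto

lemma rayleigh_minimum_exists:
  "\<exists>M' f. (\<exists>x\<in>\<Omega>. f x \<noteq> 0) \<and> energy f = - M' * sq_norm f \<and>
    (\<forall>g. - energy g \<le> M' * sq_norm g)"
proof -
  interpret neg: finite_symmetric_form \<Omega> "\<lambda>x y. - w x y" m by (rule negated_form)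
  have energy: "neg.energy f = - energy f" for f
    by (simp add: neg.energy_eq_double_sum energy_eq_double_sum sum_negf)
  obtain f M' where f: "\<exists>x\<in>\<Omega>. f x \<noteq> 0" "neg.energy f = M' * sq_norm f"
    and bound: "\<And>g. neg.energy g \<le> M' * sq_norm g"
    using neg.rayleigh_maximum_exists by blast
  show ?thesis
  proof (intro exI conjI allI)
    show "\<exists>x\<in>\<Omega>. f x \<noteq> 0" by (fact f(1))
    show "energy f = - M' * sq_norm f" using f(2) by (simp add: energy)
    show "- energy g \<le> M' * sq_norm g" for g using bound[of g] by (simp add: energy)
  qed
qed

lemma minimiser_eigenfunction:
  assumes bound: "\<And>g. - energy g \<le> M' * sq_norm g"
    and attained: "energy f = - M' * sq_norm f"
    and nonzero: "\<exists>x\<in>\<Omega>. f x \<noteq> 0"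
  shows "eigenfunction (- M') f"
proof -
  interpret neg: finite_symmetric_form \<Omega> "\<lambda>x y. - w x y" m by (rule negated_form)
  have energy: "neg.energy f = - energy f" for f
    by (simp add: neg.energy_eq_double_sum energy_eq_double_sum sum_negf)
  have "neg.eigenfunction M' f"
    using bound attained nonzero by (intro neg.maximiser_eigenfunction) (auto simp: energy)
  then show ?thesis
    unfolding eigenfunction_def neg.eigenfunction_def apply_form_def neg.apply_form_def
    by (auto simp: sum_negf)
qed

lemma minimum_le_eigenvalue:
  assumes "\<And>g. - energy g \<le> M' * sq_norm g" and "eigenfunction a f"
  shows "- M' \<le> a"
proof -
  have "sq_norm f > 0" using assms(2) sq_norm_pos unfolding eigenfunction_def by blast
  moreover have "- M' * sq_norm f \<le> a * sq_norm f"
    using assms(1)[of f] eigenfunction_energy[OF assms(2)] by simp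
  ultimately show ?thesis by (simp only: mult_le_cancel_right_pos)
qed

section \<open>Symmetry of the spectrum and two-colourings\<close>

text \<open>Every edge joins the two parts, so negating a function on one part negates each nonzero term
  of the energy and leaves the squares in the norm alone.\<close>

lemma bipartite_energy_flip:
  assumes supp: "\<And>x y. x \<in> \<Omega> \<Longrightarrow> y \<in> \<Omega> \<Longrightarrow> (x, y) \<notin> R \<Longrightarrow> w x y = 0"
    and "bipartite_graph \<Omega> R"
  shows "\<exists>s :: 'a \<Rightarrow> real. (\<forall>g. energy (\<lambda>x. s x * g x) = - energy g) \<and>
    (\<forall>g. sq_norm (\<lambda>x. s x * g x) = sq_norm g)"
proof -
  obtain A B where AB: "A \<union> B = \<Omega>" "A \<inter> B = {}" "R \<inter> (A \<times> A) = {}" "R \<inter> (B \<times> B) = {}"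
    using assms(2) unfolding bipartite_graph_def by blast
  define s :: "'a \<Rightarrow> real" where "s x = (if x \<in> A then 1 else - 1)" for x
  have flip: "w x y * (s x * g x * (s y * g y)) = - (w x y * (g x * g y))"
    if "x \<in> \<Omega>" "y \<in> \<Omega>" for x y and g :: "'a \<Rightarrow> real"
  proof (cases "(x, y) \<in> R")
    case True
    then have "x \<in> A \<longleftrightarrow> y \<notin> A" using that AB by blast
    then show ?thesis by (auto simp: s_def)
  qed (simp add: supp that)
  show ?thesis
  proof (intro exI conjI allI)
    show "energy (\<lambda>x. s x * g x) = - energy g" for g
      unfolding energy_eq_double_sum by (simp add: flip sum_negf cong: sum.cong)
    show "sq_norm (\<lambda>x. s x * g x) = sq_norm g" for g
      unfolding sq_norm_def by (intro sum.cong) (auto simp: s_def)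
  qed
qed

text \<open>At a zero of a nonnegative eigenfunction the eigenvalue equation says that a sum of
  nonnegative terms vanishes, so the zero spreads to every neighbour, and by connectedness to all
  of \<open>\<Omega>\<close>.\<close>

lemma nonneg_eigenfunction_nonzero:
  assumes nonneg: "\<And>x y. x \<in> \<Omega> \<Longrightarrow> y \<in> \<Omega> \<Longrightarrow> w x y \<ge> 0"
    and R: "R \<subseteq> \<Omega> \<times> \<Omega>" "\<And>x y. (x, y) \<in> R \<Longrightarrow> w x y > 0"
    and conn: "connected_graph \<Omega> R"
    and f: "eigenfunction a f" "\<And>x. x \<in> \<Omega> \<Longrightarrow> f x \<ge> 0"
    and x: "x \<in> \<Omega>"
  shows "f x \<noteq> 0"
proof
  assume fx: "f x = 0"
  have step: "f z = 0" if "(y, z) \<in> R" "f y = 0" for y z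
  proof -
    have yz: "y \<in> \<Omega>" "z \<in> \<Omega>" using that R by auto
    have "(\<Sum>u\<in>\<Omega>. w y u * f u) = 0"
      using f(1) yz that unfolding eigenfunction_def apply_form_def by simp
    then have "w y z * f z = 0"
      using yz nonneg f(2) by (subst (asm) sum_nonneg_eq_0_iff) (auto simp: finite_carrier)
    then show ?thesis using R(2)[OF that(1)] by simp
  qed
  have "f y = 0" if "(x, y) \<in> R\<^sup>*" for y
    using that by (induction rule: rtrancl_induct) (auto simp: fx step)
  then show False
    using f(1) conn x unfolding eigenfunction_def connected_graph_def by blast
qed

text \<open>If the minimum of the Rayleigh quotient is the negative of its maximum and \<open>f\<close> attains the
  minimum, then \<open>\<bar>f\<bar>\<close> attains the maximum, and \<open>energy \<bar>f\<bar> + energy f = 0\<close>.  Each term of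
  this sum is nonnegative, hence zero, and since \<open>\<bar>f\<bar>\<close> has no zeros this forces \<open>f\<close> to change
  sign along every edge.\<close>

lemma bipartite_if_extrema_opposite:
  assumes nonneg: "\<And>x y. x \<in> \<Omega> \<Longrightarrow> y \<in> \<Omega> \<Longrightarrow> w x y \<ge> 0"
    and R: "R \<subseteq> \<Omega> \<times> \<Omega>" "\<And>x y. (x, y) \<in> R \<Longrightarrow> w x y > 0"
    and conn: "connected_graph \<Omega> R"
    and bound: "\<And>g. energy g \<le> M * sq_norm g"
    and f: "\<exists>x\<in>\<Omega>. f x \<noteq> 0" "energy f = - M * sq_norm f"
  shows "bipartite_graph \<Omega> R"
proof -
  define h where "h x = \<bar>f x\<bar>" for x
  define d where "d x y = w x y * (h x * h y + f x * f y)" for x y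
  have d_nonneg: "d x y \<ge> 0" if "x \<in> \<Omega>" "y \<in> \<Omega>" for x y
  proof -
    have "h x * h y + f x * f y \<ge> 0"
      unfolding h_def using abs_ge_minus_self[of "f x * f y"] by (simp add: abs_mult)
    then show ?thesis unfolding d_def using nonneg[OF that] by simp
  qed
  have sum_d: "energy h + energy f = (\<Sum>x\<in>\<Omega>. \<Sum>y\<in>\<Omega>. d x y)"
    unfolding energy_eq_double_sum d_def by (simp add: sum.distrib distrib_left)
  have norm_h: "sq_norm h = sq_norm f" unfolding sq_norm_def h_def by simp
  have "(\<Sum>x\<in>\<Omega>. \<Sum>y\<in>\<Omega>. d x y) \<ge> 0" by (intro sum_nonneg d_nonneg)
  with sum_d f(2) bound[of h] norm_h
  have energy_h: "energy h = M * sq_norm h" and d0: "(\<Sum>x\<in>\<Omega>. \<Sum>y\<in>\<Omega>. d x y) = 0"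
    by auto
  have "eigenfunction M h"
    using f(1) by (intro maximiser_eigenfunction bound energy_h) (simp add: h_def)
  then have nz: "f x \<noteq> 0" if "x \<in> \<Omega>" for x
    using nonneg_eigenfunction_nonzero[OF nonneg R conn, of M h x] that by (simp add: h_def)
  have opposite: "f x * f y < 0" if "(x, y) \<in> R" for x y
  proof -
    have xy: "x \<in> \<Omega>" "y \<in> \<Omega>" using that R by auto
    have "(\<Sum>y\<in>\<Omega>. d x y) = 0"
      using d0 xy sum_nonneg_eq_0_iff[OF finite_carrier, of "\<lambda>x. \<Sum>y\<in>\<Omega>. d x y"]
      by (simp add: sum_nonneg d_nonneg)
    then have "d x y = 0"
      using xy sum_nonneg_eq_0_iff[OF finite_carrier, of "d x"] by (simp add: d_nonneg)
    then have "f x * f y = - \<bar>f x * f y\<bar>"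
      using R(2)[OF that] by (simp add: d_def h_def abs_mult)
    moreover have "f x * f y \<noteq> 0" using nz xy by simp
    ultimately show ?thesis by linarith
  qed
  show ?thesis unfolding bipartite_graph_def
  proof (intro exI conjI)
    show "{x \<in> \<Omega>. f x > 0} \<union> {x \<in> \<Omega>. f x < 0} = \<Omega>" using nz by (auto simp: neq_iff)
    show "{x \<in> \<Omega>. f x > 0} \<inter> {x \<in> \<Omega>. f x < 0} = {}" by auto
    show "R \<inter> ({x \<in> \<Omega>. f x > 0} \<times> {x \<in> \<Omega>. f x > 0}) = {}"
      using opposite by (force simp: mult_less_0_iff)
    show "R \<inter> ({x \<in> \<Omega>. f x < 0} \<times> {x \<in> \<Omega>. f x < 0}) = {}"
      using opposite by (force simp: mult_less_0_iff)
  qed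
qed

end

section \<open>The Dirichlet Laplacian\<close>

lemma (in infinite_weighted_graph) vertex_weight_pos:
  assumes "(x, y) \<in> E"
  shows "vertex_weight V \<mu> x > 0"
proof -
  have V: "x \<in> V" "y \<in> V" using assms edges_subset by auto
  let ?F = "{y \<in> V. (x, y) \<in> E}"
  have "vertex_weight V \<mu> x = (\<Sum>\<^sub>\<infinity>y\<in>?F. \<mu> x y)"
    unfolding vertex_weight_def
  proof (rule infsum_cong_neutral)
    show "\<mu> x z = 0" if "z \<in> V - ?F" for z
      using that weight_nonneg[of x z] weight_pos_iff[of x z] V by auto
  qed auto
  also have "\<dots> = sum (\<mu> x) ?F" using locally_finite[OF V(1)] by simp
  also have "\<dots> > 0"
    using locally_finite[OF V(1)] assms V weight_nonneg[of x] weight_pos_iff[of x]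
    by (intro sum_pos2[of ?F y]) auto
  finally show ?thesis .
qed

lemma connected_graph_has_neighbour:
  assumes "connected_graph W F" and "card W \<ge> 2" and "x \<in> W"
  obtains y where "(x, y) \<in> F"
proof -
  have "\<not> W \<subseteq> {x}" using assms(2) card_mono[of "{x}" W] by auto
  then obtain y where "y \<in> W" "y \<noteq> x" by blast
  then have "(x, y) \<in> F\<^sup>*" using assms unfolding connected_graph_def by blast
  then show ?thesis using \<open>y \<noteq> x\<close> that by (auto elim: converse_rtranclE)
qed

theorem theorem3p1:
  fixes V :: "'a set" and E :: "('a \<times> 'a) set" and \<mu> :: "'a \<Rightarrow> 'a \<Rightarrow> real" and \<Omega> :: "'a set"
  assumes "infinite_weighted_graph V E \<mu>"
    and "\<Omega> \<subseteq> V" and "finite \<Omega>" and "card \<Omega> \<ge> 2"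
    and "connected_graph \<Omega> (induced_edges E \<Omega>)"
  shows "lambda_1 V \<mu> \<Omega> + lambda_max V \<mu> \<Omega> = 2 \<longleftrightarrow> bipartite_graph \<Omega> (induced_edges E \<Omega>)"
proof -
  interpret graph: infinite_weighted_graph V E \<mu> by fact
  let ?R = "induced_edges E \<Omega>"
  let ?m = "vertex_weight V \<mu>"
  have m_pos: "?m x > 0" if x: "x \<in> \<Omega>" for x
  proof -
    obtain y where "(x, y) \<in> ?R"
      using connected_graph_has_neighbour[OF assms(5,4) x] by blast
    then show ?thesis by (intro graph.vertex_weight_pos) (auto simp: induced_edges_def)
  qed
  interpret finite_symmetric_form \<Omega> \<mu> ?m
  proof
    show "\<Omega> \<noteq> {}" using assms(4) by auto
    show "\<mu> x y = \<mu> y x" if "x \<in> \<Omega>" "y \<in> \<Omega>" for x y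
      using that assms(2) graph.weight_sym by blast
  qed (use assms(3) m_pos in auto)
  have nonneg: "\<mu> x y \<ge> 0" if "x \<in> \<Omega>" "y \<in> \<Omega>" for x y
    using that assms(2) graph.weight_nonneg by blast
  have R_pos: "\<mu> x y > 0" if "(x, y) \<in> ?R" for x y
    using that assms(2) graph.weight_pos_iff unfolding induced_edges_def by auto
  have R_sub: "?R \<subseteq> \<Omega> \<times> \<Omega>" unfolding induced_edges_def by auto
  have supp: "\<mu> x y = 0" if "x \<in> \<Omega>" "y \<in> \<Omega>" "(x, y) \<notin> ?R" for x y
    using that assms(2) graph.weight_pos_iff[of x y] nonneg[of x y]
    unfolding induced_edges_def by auto
  have eigenvalue_iff: "dirichlet_eigenvalue V \<mu> \<Omega> l \<longleftrightarrow> (\<exists>f. eigenfunction (1 - l) f)" for l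
  proof -
    have "dirichlet_laplace V \<mu> \<Omega> f x = l * f x \<longleftrightarrow> apply_form f x = (1 - l) * ?m x * f x"
      if "x \<in> \<Omega>" for f x
      unfolding dirichlet_laplace_def apply_form_def using m_pos[OF that]
      by (auto simp: field_simps)
    then show ?thesis unfolding dirichlet_eigenvalue_def eigenfunction_def by simp
  qed
  obtain f M where f: "\<exists>x\<in>\<Omega>. f x \<noteq> 0" "energy f = M * sq_norm f"
    and M: "\<And>g. energy g \<le> M * sq_norm g"
    using rayleigh_maximum_exists by blast
  obtain f' M' where f': "\<exists>x\<in>\<Omega>. f' x \<noteq> 0" "energy f' = - M' * sq_norm f'"
    and M': "\<And>g. - energy g \<le> M' * sq_norm g"
    using rayleigh_minimum_exists by blast
  have "lambda_1 V \<mu> \<Omega> = 1 - M" unfolding lambda_1_def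
  proof (rule Least_equality)
    show "dirichlet_eigenvalue V \<mu> \<Omega> (1 - M)"
      unfolding eigenvalue_iff using maximiser_eigenfunction[OF M f(2,1)] by auto
    show "1 - M \<le> l" if "dirichlet_eigenvalue V \<mu> \<Omega> l" for l
      using that eigenvalue_le_maximum[OF M] unfolding eigenvalue_iff by fastforce
  qed
  moreover have "lambda_max V \<mu> \<Omega> = 1 + M'" unfolding lambda_max_def
  proof (rule Greatest_equality)
    show "dirichlet_eigenvalue V \<mu> \<Omega> (1 + M')"
      unfolding eigenvalue_iff using minimiser_eigenfunction[OF M' f'(2,1)] by auto
    show "l \<le> 1 + M'" if "dirichlet_eigenvalue V \<mu> \<Omega> l" for l
      using that minimum_le_eigenvalue[OF M'] unfolding eigenvalue_iff by fastforce
  qed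
  ultimately have "lambda_1 V \<mu> \<Omega> + lambda_max V \<mu> \<Omega> = 2 \<longleftrightarrow> M = M'" by auto
  also have "M = M' \<longleftrightarrow> bipartite_graph \<Omega> ?R"
  proof
    assume "M = M'"
    then show "bipartite_graph \<Omega> ?R"
      using bipartite_if_extrema_opposite[OF nonneg R_sub R_pos assms(5) M f'(1)] f'(2) by simp
  next
    assume "bipartite_graph \<Omega> ?R"
    then obtain s :: "'a \<Rightarrow> real" where
      s: "\<And>g. energy (\<lambda>x. s x * g x) = - energy g" "\<And>g. sq_norm (\<lambda>x. s x * g x) = sq_norm g"
      using bipartite_energy_flip[OF supp] by blast
    have "M * sq_norm f \<le> M' * sq_norm f"
      using M'[of "\<lambda>x. s x * f x"] f(2) by (simp add: s)
    moreover have "M' * sq_norm f' \<le> M * sq_norm f'"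
      using M[of "\<lambda>x. s x * f' x"] f'(2) by (simp add: s)
    ultimately show "M = M'" using sq_norm_pos[OF f(1)] sq_norm_pos[OF f'(1)] by simp
  qed
  finally show ?thesis .
qed

end
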